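(* Let $n\ge2$ be an integer and $A\subseteq n^{<\omega}$. If $\xi<\omega_1$, $r\in\omega$ and $R(A)=\omega\cdot\xi+r$, then $A^\infty\in\mathbf{\Sigma}^0_{2\cdot\xi+1}$.
   Context: $n=\{0,\dots,n-1\}$ is a finite alphabet, $n^{<\omega}$ is the set of finite words over it, and $n^\omega$ has the product topology. For $A\subseteq n^{<\omega}$, $A^\infty:=\{a_0a_1a_2\ldots\in n^\omega : \forall i\in\omega\ a_i\in A\}$ and $A^-:=A\setminus\{\emptyset\}$ (remove the empty word). For $\alpha\in n^\omega$, $T_A(\alpha)$ is the tree on $A^-$ consisting of the finite sequences $S=(S(0),\dots,S(k-1))$ of elements of $A^-$ (including the empty sequence) whose concatenation $S(0)\cdots S(k-1)$ is an initial segment of $\alpha$; it is well founded if and only if $\alpha\notin A^\infty$. For a well-founded tree $T$, $\rho_T(s):=\sup\{\rho_T(t)+1 : t\in T,\ t\text{ a proper extension of }s\}$ for $s\in T$, and $\rho(T):=\sup\{\rho_T(s)+1 : s\in T\}$. Finally $R(A):=\sup\{\rho(T_A(\alpha)) : \alpha\in n^\omega\setminus A^\infty\}$ (with $\sup\emptyset=0$). Ordinal multiplication is the usual one: $\omega\cdot\xi$ is $\omega$ added to itself $\xi$ times, $2\cdot\xi$ is $2$ added to itself $\xi$ times (so $2\cdot\omega=\omega$). *)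

theory Defs
  imports "HOL-Analysis.Analysis" "HOL-Library.Sublist"
begin

section \<open>Ordinals\<close>

text \<open>
  HOL has no type of all ordinals. We use the ordinals below the second uncountable cardinal:
  this type contains the first uncountable ordinal, and every set of at most that cardinality has
  a supremum in it. All ordinals arising below (in particular all ranks of well-founded trees of
  finite words, and suprema of arbitrary sets of such ranks) are at most the first uncountable
  ordinal, so nothing is truncated.
\<close>

unbundle cardinal_syntax

abbreviation aleph2 :: "nat set set rel" where
  "aleph2 \<equiv> cardSuc (cardSuc natLeq)"

lemma Card_order_aleph1: "Card_order (cardSuc natLeq)"
  by (simp add: cardSuc_Card_order natLeq_Card_order)

lemma Card_order_aleph2: "Card_order aleph2"
  by (simp add: cardSuc_Card_order Card_order_aleph1)

lemma Well_order_aleph2: "Well_order aleph2"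
  using Card_order_aleph2 card_order_on_well_order_on by blast

lemma infinite_aleph1: "\<not> finite (Field (cardSuc natLeq))"
  by (metis Field_natLeq cardSuc_finite infinite_UNIV_nat natLeq_Card_order)

typedef ordinal = "Field aleph2"
  morphisms ord_rep ord_abs
  using Field_cardSuc_not_empty[OF Card_order_aleph1] by blast

instantiation ordinal :: linorder
begin

definition less_eq_ordinal :: "ordinal \<Rightarrow> ordinal \<Rightarrow> bool" where
  "x \<le> y \<longleftrightarrow> (ord_rep x, ord_rep y) \<in> aleph2"

definition less_ordinal :: "ordinal \<Rightarrow> ordinal \<Rightarrow> bool" where
  "(x::ordinal) < y \<longleftrightarrow> x \<le> y \<and> x \<noteq> y"

instance
proof -
  have lin: "Linear_order aleph2"
    using Well_order_aleph2 by (simp add: well_order_on_def)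
  hence refl: "(a, a) \<in> aleph2" if "a \<in> Field aleph2" for a
    using that by (meson order_on_defs refl_onD)
  have trans: "trans aleph2" and antisym: "antisym aleph2"
    using lin by (auto simp: order_on_defs)
  have total: "(a, b) \<in> aleph2 \<or> (b, a) \<in> aleph2"
    if "a \<in> Field aleph2" "b \<in> Field aleph2" for a b
    using lin refl that by (metis order_on_defs(3) total_on_def)
  have anti: "x = y" if "x \<le> y" "y \<le> x" for x y :: ordinal
    using that antisym unfolding less_eq_ordinal_def
    by (metis antisymD ord_rep_inject)
  show "OFCLASS(ordinal, linorder_class)"
  proof
    fix x y z :: ordinal
    show "x < y \<longleftrightarrow> x \<le> y \<and> \<not> y \<le> x"
      using anti refl ord_rep[of x] unfolding less_ordinal_def less_eq_ordinal_def by auto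
    show "x \<le> x" using refl ord_rep[of x] by (simp add: less_eq_ordinal_def)
    show "x \<le> z" if "x \<le> y" "y \<le> z"
      using that trans unfolding less_eq_ordinal_def by (meson transD)
    show "x = y" if "x \<le> y" "y \<le> x" using that anti by blast
    show "x \<le> y \<or> y \<le> x"
      using total ord_rep[of x] ord_rep[of y] by (simp add: less_eq_ordinal_def)
  qed
qed

end

instance ordinal :: wellorder
proof
  fix P :: "ordinal \<Rightarrow> bool" and a :: ordinal
  assume step: "\<And>x. (\<And>y. y < x \<Longrightarrow> P y) \<Longrightarrow> P x"
  have "wf (aleph2 - Id)"
    using Well_order_aleph2 by (simp add: well_order_on_def)
  hence "wf (inv_image (aleph2 - Id) ord_rep)" by (rule wf_inv_image)
  thus "P a"
  proof (induction a rule: wf_induct_rule)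
    case (less x)
    show ?case
      by (rule step, rule less)
        (auto simp: less_ordinal_def less_eq_ordinal_def ord_rep_inject)
  qed
qed

instantiation ordinal :: conditionally_complete_linorder
begin

definition inf_ordinal :: "ordinal \<Rightarrow> ordinal \<Rightarrow> ordinal" where "inf_ordinal = min"
definition sup_ordinal :: "ordinal \<Rightarrow> ordinal \<Rightarrow> ordinal" where "sup_ordinal = max"
definition Inf_ordinal :: "ordinal set \<Rightarrow> ordinal" where
  "Inf S = (LEAST x::ordinal. x \<in> S)"
text \<open>The least upper bound; in particular the supremum of the empty set is the least ordinal.\<close>
definition Sup_ordinal :: "ordinal set \<Rightarrow> ordinal" where
  "Sup S = (LEAST x::ordinal. \<forall>y\<in>S. y \<le> x)"

instance
proof
  fix x y z :: ordinal and X :: "ordinal set"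
  show "Inf X \<le> x" if "x \<in> X"
    unfolding Inf_ordinal_def using that by (rule Least_le)
  show "z \<le> Inf X" if "X \<noteq> {}" "\<And>x. x \<in> X \<Longrightarrow> z \<le> x"
    unfolding Inf_ordinal_def using that by (metis LeastI ex_in_conv)
  show "x \<le> Sup X" if "x \<in> X" "bdd_above X"
    unfolding Sup_ordinal_def using that LeastI_ex[of "\<lambda>x. \<forall>y\<in>X. y \<le> x"]
    by (auto simp: bdd_above_def)
  show "Sup X \<le> z" if "\<And>x. x \<in> X \<Longrightarrow> x \<le> z"
    unfolding Sup_ordinal_def using that by (auto intro: Least_le)
qed (auto simp: inf_ordinal_def sup_ordinal_def)

end

lemma card_of_lessThan_ordinal: "|{..<x::ordinal}| \<le>o cardSuc natLeq"
proof -
  have "ord_rep ` {..<x} \<subseteq> underS aleph2 (ord_rep x)"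
    by (auto simp: underS_def less_ordinal_def less_eq_ordinal_def ord_rep_inject)
  hence "|{..<x}| \<le>o |underS aleph2 (ord_rep x)|"
    by (meson card_of_ordLeqI imageI inj_onI ord_rep_inject subsetD)
  also have "|underS aleph2 (ord_rep x)| <o aleph2"
    using card_of_underS[OF Card_order_aleph2 ord_rep] .
  finally show ?thesis
    using cardSuc_ordLeq_ordLess[OF Card_order_aleph1 card_of_Card_order] by blast
qed

lemma bdd_above_ordinal:
  assumes "|S :: ordinal set| \<le>o cardSuc natLeq"
  shows "bdd_above S"
proof -
  have "\<exists>i\<in>Field aleph2. ord_rep ` S \<subseteq> under aleph2 i"
  proof (rule cardSuc_UNION[OF Card_order_aleph1 infinite_aleph1])
    show "relChain aleph2 (under aleph2)"
      using Well_order_aleph2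
      by (metis relChain_def order_on_defs(1,2,3) well_order_on_def under_incr)
    show "ord_rep ` S \<subseteq> (\<Union>i\<in>Field aleph2. under aleph2 i)"
      using ord_rep Well_order_aleph2
      by (fastforce simp: under_def well_order_on_def order_on_defs dest: refl_onD)
    show "|ord_rep ` S| \<le>o cardSuc natLeq"
      using assms card_of_image ordLeq_transitive by blast
  qed
  then obtain i where i: "i \<in> Field aleph2" "ord_rep ` S \<subseteq> under aleph2 i" by blast
  have "x \<le> ord_abs i" if "x \<in> S" for x
    using i that by (auto simp: less_eq_ordinal_def under_def ord_abs_inverse)
  thus ?thesis by (auto simp: bdd_above_def)
qed

lemma bdd_above_image_ordinal: "bdd_above (f ` {..<x::ordinal} :: ordinal set)"
  by (meson bdd_above_ordinal card_of_image card_of_lessThan_ordinal ordLeq_transitive)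

lemma bdd_above_countable_ordinal:
  assumes "countable (S :: ordinal set)"
  shows "bdd_above S"
proof (rule bdd_above_ordinal)
  have "|S| \<le>o |UNIV :: nat set|"
    using assms by (auto simp: countable_def card_of_ordLeq[symmetric])
  also have "|UNIV :: nat set| \<le>o cardSuc natLeq"
    using card_of_nat cardSuc_ordLeq[OF natLeq_Card_order] ordIso_ordLeq_trans by blast
  finally show "|S| \<le>o cardSuc natLeq" .
qed

definition ord_succ :: "ordinal \<Rightarrow> ordinal" where
  "ord_succ x = (LEAST y. x < y)"

lemma ord_succ_le_iff: "ord_succ x \<le> y \<longleftrightarrow> x < y"
proof -
  have "\<exists>y. x < y"
  proof (rule ccontr)
    assume "\<nexists>y. x < y"
    hence *: "y \<le> x" for y by (metis not_less)
    have "Field aleph2 \<subseteq> insert (ord_rep x) (ord_rep ` {..<x})"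
    proof
      fix a assume "a \<in> Field aleph2"
      then obtain y where "a = ord_rep y" by (metis ord_abs_inverse)
      thus "a \<in> insert (ord_rep x) (ord_rep ` {..<x})" using *[of y] by (cases "y = x") auto
    qed
    moreover have "|insert (ord_rep x) (ord_rep ` {..<x})| \<le>o cardSuc natLeq"
    proof -
      have "|ord_rep ` {..<x}| \<le>o cardSuc natLeq"
        using card_of_image card_of_lessThan_ordinal ordLeq_transitive by blast
      moreover have "|{ord_rep x}| \<le>o cardSuc natLeq"
        using Card_order_singl_ordLeq[OF Card_order_aleph1, of "ord_rep x"] infinite_aleph1
        by fastforce
      ultimately have "|{ord_rep x} \<union> ord_rep ` {..<x}| \<le>o cardSuc natLeq"
        using card_of_Un_ordLeq_infinite_Field[OF infinite_aleph1] Card_order_aleph1 by blast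
      thus ?thesis by simp
    qed
    ultimately have "|Field aleph2| \<le>o cardSuc natLeq"
      using ordLeq_transitive[OF card_of_mono1] by simp
    hence "aleph2 \<le>o cardSuc natLeq"
      by (rule ordIso_ordLeq_trans[OF ordIso_symmetric[OF card_of_Field_ordIso[OF Card_order_aleph2]]])
    thus False
      using cardSuc_greater[OF Card_order_aleph1] not_ordLess_ordLeq by metis
  qed
  thus ?thesis
    unfolding ord_succ_def by (meson LeastI_ex Least_le order_less_le_trans)
qed

lemma less_ord_succ_iff: "x < ord_succ y \<longleftrightarrow> x \<le> y"
  using ord_succ_le_iff[of y x] by (metis not_less)

instantiation ordinal :: "{zero, one, plus, times}"
begin

definition zero_ordinal :: ordinal where "0 = (LEAST x::ordinal. True)"

definition one_ordinal :: ordinal where "1 = ord_succ 0"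

text \<open>Recursion on the second argument, successor and limit steps at once:
  \<open>a + b = sup ({a} \<union> {(a + c) + 1 | c < b})\<close> and \<open>a * b = sup {a * c + a | c < b}\<close>.\<close>

function plus_ordinal :: "ordinal \<Rightarrow> ordinal \<Rightarrow> ordinal" where
  "plus_ordinal a b = Sup (insert a ((\<lambda>c. ord_succ (plus_ordinal a c)) ` {..<b}))"
  by auto
termination
  by (relation "inv_image {(x, y). x < y} snd") (auto simp: wf)

declare plus_ordinal.simps [simp del]

function times_ordinal :: "ordinal \<Rightarrow> ordinal \<Rightarrow> ordinal" where
  "times_ordinal a b = Sup ((\<lambda>c. times_ordinal a c + a) ` {..<b})"
  by auto
termination
  by (relation "inv_image {(x, y). x < y} snd") (auto simp: wf)

declare times_ordinal.simps [simp del]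

instance ..

end

fun ord_of_nat :: "nat \<Rightarrow> ordinal" where
  "ord_of_nat 0 = 0"
| "ord_of_nat (Suc k) = ord_of_nat k + 1"

definition omega :: ordinal ("\<omega>") where
  "\<omega> = Sup (range ord_of_nat)"

definition omega1 :: ordinal ("\<omega>\<^sub>1") where
  "\<omega>\<^sub>1 = (LEAST x. uncountable {..<x})"

lemma zero_le_ordinal [simp]: "0 \<le> (x :: ordinal)"
  by (simp add: zero_ordinal_def Least_le)

lemma Sup_empty_ordinal [simp]: "Sup {} = (0 :: ordinal)"
  by (simp add: Sup_ordinal_def zero_ordinal_def)

lemma ordinal_lessThan_zero [simp]: "{..<0::ordinal} = {}"
  by (metis lessThan_iff not_less zero_le_ordinal equals0I)

lemma ordinal_lessThan_succ: "{..<ord_succ x} = insert x {..<x}"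
  by (auto simp: less_ord_succ_iff)

lemma ordinal_add_zero [simp]: "a + 0 = (a :: ordinal)"
  by (subst plus_ordinal.simps) simp

lemma ordinal_add_upper: "c < b \<Longrightarrow> ord_succ (a + c) \<le> a + b" for a b c :: ordinal
  by (subst (2) plus_ordinal.simps) (auto intro!: cSup_upper simp: bdd_above_image_ordinal)

lemma ordinal_add_succ: "a + ord_succ b = ord_succ (a + b)"
proof (rule antisym)
  have le: "ord_succ (a + c) \<le> ord_succ (a + b)" if "c \<le> b" for c
    using that ordinal_add_upper[of c b a]
    by (metis less_ord_succ_iff ord_succ_le_iff order_le_less order_less_trans)
  have "a \<le> a + b"
    by (subst plus_ordinal.simps) (auto intro!: cSup_upper simp: bdd_above_image_ordinal)
  hence "a \<le> ord_succ (a + b)" using less_ord_succ_iff by (simp add: order_less_imp_le)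
  thus "a + ord_succ b \<le> ord_succ (a + b)"
    by (subst plus_ordinal.simps) (auto intro!: cSup_least le simp: less_ord_succ_iff)
qed (auto intro: ordinal_add_upper simp: less_ord_succ_iff)

lemma ordinal_add_one: "a + 1 = ord_succ (a :: ordinal)"
  by (simp add: one_ordinal_def ordinal_add_succ)

lemma ordinal_mult_zero [simp]: "a * 0 = (0 :: ordinal)"
  by (subst times_ordinal.simps) simp

lemma ordinal_add_mono_left:
  fixes a a' b :: ordinal
  assumes "a \<le> a'"
  shows "a + b \<le> a' + b"
proof (induction b rule: less_induct)
  case (less b)
  have "a' \<le> a' + b"
    by (subst plus_ordinal.simps) (auto intro!: cSup_upper simp: bdd_above_image_ordinal)
  moreover have "ord_succ (a + c) \<le> a' + b" if "c < b" for c
    using less[OF that] ordinal_add_upper[OF that, of a'] unfolding ord_succ_le_iff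
    by (rule le_less_trans)
  ultimately show ?case
    using assms by (subst plus_ordinal.simps) (auto intro!: cSup_least)
qed

lemma ordinal_mult_upper: "c < b \<Longrightarrow> a * c + a \<le> a * b" for a b c :: ordinal
  by (subst (2) times_ordinal.simps) (auto intro!: cSup_upper simp: bdd_above_image_ordinal)

lemma ordinal_mult_succ: "a * ord_succ b = a * b + a"
proof (rule antisym)
  have "a * c \<le> a * b" if "c \<le> b" for c
  proof (cases "c = b")
    case False
    have "a * c \<le> a * c + a"
      by (subst plus_ordinal.simps) (auto intro!: cSup_upper simp: bdd_above_image_ordinal)
    also have "\<dots> \<le> a * b" using that False by (simp add: ordinal_mult_upper)
    finally show ?thesis .
  qed simp
  thus "a * ord_succ b \<le> a * b + a"
    by (subst times_ordinal.simps)
      (auto intro!: cSup_least ordinal_add_mono_left simp: ordinal_lessThan_succ)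
qed (auto intro: ordinal_mult_upper simp: less_ord_succ_iff)

lemma less_omega1_iff: "x < \<omega>\<^sub>1 \<longleftrightarrow> countable {..<x}"
proof -
  have "cardSuc natLeq <o aleph2"
    by (rule cardSuc_greater[OF Card_order_aleph1])
  then obtain a where a: "a \<in> Field aleph2"
      "(cardSuc natLeq, Restr aleph2 (underS aleph2 a)) \<in> ordIso"
    using ordLess_iff_ordIso_Restr[OF Well_order_aleph2] Card_order_aleph1
      card_order_on_well_order_on by blast
  have "uncountable {..<ord_abs a}"
  proof
    assume c: "countable {..<ord_abs a}"
    have "underS aleph2 a \<subseteq> ord_rep ` {..<ord_abs a}"
    proof
      fix b assume b: "b \<in> underS aleph2 a"
      hence "b \<in> Field aleph2" by (auto simp: underS_def Field_def)
      moreover from this b have "ord_abs b < ord_abs a"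
        using a(1)
        by (auto simp: underS_def less_ordinal_def less_eq_ordinal_def ord_abs_inverse ord_abs_inject)
      ultimately show "b \<in> ord_rep ` {..<ord_abs a}"
        by (metis imageI lessThan_iff ord_abs_inverse)
    qed
    hence "countable (underS aleph2 a)" using c by (meson countable_image countable_subset)
    hence "countable (Field (Restr aleph2 (underS aleph2 a)))"
      by (rule countable_subset[rotated]) (auto simp: Field_def)
    hence "|Field (Restr aleph2 (underS aleph2 a))| \<le>o natLeq"
      by (metis countable_def card_of_ordLeq card_of_nat ordLeq_ordIso_trans subset_UNIV)
    moreover have "|Field (cardSuc natLeq)| =o |Field (Restr aleph2 (underS aleph2 a))|"
      using a(2) card_of_cong by blast
    moreover have "cardSuc natLeq =o |Field (cardSuc natLeq)|"
      using card_of_Field_ordIso[OF Card_order_aleph1] ordIso_symmetric by blast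
    ultimately have "cardSuc natLeq \<le>o natLeq"
      by (meson ordIso_ordLeq_trans)
    thus False
      using cardSuc_greater[OF natLeq_Card_order] not_ordLess_ordLeq by metis
  qed
  hence u: "uncountable {..<\<omega>\<^sub>1}" unfolding omega1_def by (rule LeastI)
  show ?thesis
  proof
    show "countable {..<x}" if "x < \<omega>\<^sub>1"
      using that not_less_Least unfolding omega1_def by blast
    show "x < \<omega>\<^sub>1" if "countable {..<x}"
      using that u by (metis countable_subset lessThan_subset_iff not_less)
  qed
qed

lemma Sup_less_omega1:
  assumes "countable S" "S \<subseteq> {..<\<omega>\<^sub>1}"
  shows "Sup S < \<omega>\<^sub>1"
proof -
  have "{..<Sup S} \<subseteq> (\<Union>x\<in>S. {..<x})"
  proof (cases "S = {}")
    case False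
    thus ?thesis
      using less_cSup_iff[OF False bdd_above_countable_ordinal[OF assms(1)]] by blast
  qed simp
  moreover have "countable (\<Union>x\<in>S. {..<x})"
    using assms less_omega1_iff by auto
  ultimately show ?thesis by (simp add: less_omega1_iff countable_subset)
qed

lemma add_one_less_omega1: "x < \<omega>\<^sub>1 \<Longrightarrow> x + 1 < \<omega>\<^sub>1"
  by (simp add: less_omega1_iff ordinal_add_one ordinal_lessThan_succ)

unbundle no cardinal_syntax

section \<open>The Borel hierarchy\<close>

text \<open>Levels are indexed by ordinals \<open>\<ge> 1\<close>; there are no sets at level \<open>0\<close>.\<close>

inductive sigma0_in :: "'a topology \<Rightarrow> ordinal \<Rightarrow> 'a set \<Rightarrow> bool"
  and pi0_in :: "'a topology \<Rightarrow> ordinal \<Rightarrow> 'a set \<Rightarrow> bool"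
  for X :: "'a topology"
where
  sigma0_open: "openin X U \<Longrightarrow> sigma0_in X 1 U"
| pi0_compl: "sigma0_in X \<xi> U \<Longrightarrow> pi0_in X \<xi> (topspace X - U)"
| sigma0_Union: "1 < \<xi> \<Longrightarrow> (\<And>i::nat. \<eta> i < \<xi> \<and> pi0_in X (\<eta> i) (P i))
    \<Longrightarrow> sigma0_in X \<xi> (\<Union>i. P i)"

section \<open>Well-founded trees and their ranks\<close>

text \<open>\<open>(t, s) \<in> tree_rel T\<close> iff \<open>t\<close> is a proper extension of \<open>s\<close> in \<open>T\<close>; the tree \<open>T\<close> is
  well-founded iff this relation is.\<close>

definition tree_rel :: "'a list set \<Rightarrow> ('a list \<times> 'a list) set" where
  "tree_rel T = {(t, s). s \<in> T \<and> t \<in> T \<and> strict_prefix s t}"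

text \<open>Only meaningful when \<open>tree_rel T\<close> is well-founded, see \<open>node_rank_eq\<close>.\<close>

definition node_rank :: "'a list set \<Rightarrow> 'a list \<Rightarrow> ordinal" where
  "node_rank T = wfrec (tree_rel T) (\<lambda>rk s. SUP t \<in> {t. (t, s) \<in> tree_rel T}. rk t + 1)"

lemma node_rank_eq:
  assumes "wf (tree_rel T)" "s \<in> T"
  shows "node_rank T s = (SUP t \<in> {t \<in> T. strict_prefix s t}. node_rank T t + 1)"
proof -
  have "node_rank T s =
      (SUP t \<in> {t. (t, s) \<in> tree_rel T}. cut (node_rank T) (tree_rel T) s t + 1)"
    unfolding node_rank_def by (subst wfrec[OF assms(1)]) simp
  also have "\<dots> = (SUP t \<in> {t \<in> T. strict_prefix s t}. node_rank T t + 1)"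
    using assms(2) by (intro SUP_cong) (auto simp: tree_rel_def cut_apply)
  finally show ?thesis .
qed

definition tree_rank :: "'a list set \<Rightarrow> ordinal" where
  "tree_rank T = (SUP s \<in> T. node_rank T s + 1)"

lemma tree_rank_less_omega1:
  assumes "countable T" "wf (tree_rel T)"
  shows "tree_rank T < \<omega>\<^sub>1"
proof -
  have "s \<in> T \<longrightarrow> node_rank T s < \<omega>\<^sub>1" for s
    using assms(2)
  proof (induction s rule: wf_induct_rule)
    case (less s)
    show ?case
    proof
      assume s: "s \<in> T"
      have "countable {t \<in> T. strict_prefix s t}"
        using assms(1) by (rule countable_subset[rotated]) auto
      thus "node_rank T s < \<omega>\<^sub>1"
        unfolding node_rank_eq[OF assms(2) s]
        using less s by (intro Sup_less_omega1) (auto simp: tree_rel_def intro: add_one_less_omega1)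
    qed
  qed
  thus ?thesis
    unfolding tree_rank_def using assms(1)
    by (intro Sup_less_omega1) (auto intro: add_one_less_omega1)
qed

section \<open>Infinite powers of languages\<close>

abbreviation cantor :: "nat \<Rightarrow> (nat \<Rightarrow> nat) topology" where
  "cantor n \<equiv> product_topology (\<lambda>_. discrete_topology {..<n}) UNIV"

definition initial_segment :: "'a list \<Rightarrow> (nat \<Rightarrow> 'a) \<Rightarrow> bool" where
  "initial_segment w \<alpha> \<longleftrightarrow> w = map \<alpha> [0..<length w]"

text \<open>The word \<open>a 0 a 1 a 2 \<dots>\<close> is the infinite sequence \<open>\<alpha>\<close>. The second conjunct excludes sequences
  of words that are eventually empty, whose concatenation is a finite word.\<close>

definition is_inf_concat :: "(nat \<Rightarrow> 'a list) \<Rightarrow> (nat \<Rightarrow> 'a) \<Rightarrow> bool" where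
  "is_inf_concat a \<alpha> \<longleftrightarrow>
     (\<forall>k. initial_segment (concat (map a [0..<k])) \<alpha>) \<and>
     (\<forall>m. \<exists>k. m \<le> length (concat (map a [0..<k])))"

definition inf_power :: "nat \<Rightarrow> nat list set \<Rightarrow> (nat \<Rightarrow> nat) set" where
  "inf_power n A = {\<alpha> \<in> topspace (cantor n). \<exists>a. (\<forall>i. a i \<in> A) \<and> is_inf_concat a \<alpha>}"

definition factor_tree :: "nat list set \<Rightarrow> (nat \<Rightarrow> nat) \<Rightarrow> nat list list set" where
  "factor_tree A \<alpha> = {S. set S \<subseteq> A - {[]} \<and> initial_segment (concat S) \<alpha>}"

definition R_rank :: "nat \<Rightarrow> nat list set \<Rightarrow> ordinal" where
  "R_rank n A = (SUP \<alpha> \<in> topspace (cantor n) - inf_power n A. tree_rank (factor_tree A \<alpha>))"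

lemma initial_segment_prefix:
  assumes "initial_segment w \<alpha>" "prefix v w"
  shows "initial_segment v \<alpha>"
proof -
  have "v = take (length v) w" using assms(2) by (auto simp: prefix_def)
  also have "\<dots> = take (length v) (map \<alpha> [0..<length w])"
    using assms(1) unfolding initial_segment_def by (rule arg_cong)
  also have "\<dots> = map \<alpha> [0..<length v]"
    using prefix_length_le[OF assms(2)] by (simp add: take_map take_upt)
  finally show ?thesis unfolding initial_segment_def .
qed

lemma wf_factor_tree_iff:
  assumes "\<alpha> \<in> topspace (cantor n)"
  shows "wf (tree_rel (factor_tree A \<alpha>)) \<longleftrightarrow> \<alpha> \<notin> inf_power n A"
proof
  assume wf: "wf (tree_rel (factor_tree A \<alpha>))"
  show "\<alpha> \<notin> inf_power n A"
  proof
    assume "\<alpha> \<in> inf_power n A"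
    then obtain a where a: "\<And>i. a i \<in> A" "is_inf_concat a \<alpha>"
      by (auto simp: inf_power_def)
    define S where "S k = filter (\<lambda>w. w \<noteq> []) (map a [0..<k])" for k
    have concat: "concat (S k) = concat (map a [0..<k])" for k
      unfolding S_def by (induction k) auto
    have tree: "S k \<in> factor_tree A \<alpha>" for k
      using a by (auto simp: factor_tree_def concat is_inf_concat_def) (auto simp: S_def)
    have "\<exists>l. (S l, S k) \<in> tree_rel (factor_tree A \<alpha>)" for k
    proof -
      obtain l where l: "Suc (length (concat (S k))) \<le> length (concat (S l))"
        using a(2) unfolding is_inf_concat_def concat by blast
      have pre: "prefix (S i) (S j)" if "i \<le> j" for i j
        unfolding S_def using upt_add_eq_append[of 0 i "j - i"] that
        by (auto simp: prefix_def)
      have "k \<le> l"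
      proof (rule ccontr)
        assume "\<not> k \<le> l"
        then obtain u where "S k = S l @ u" using pre[of l k] by (auto simp: prefix_def)
        thus False using l by simp
      qed
      hence "strict_prefix (S k) (S l)"
        using pre[of k l] l by (auto simp: strict_prefix_def)
      thus ?thesis using tree by (auto simp: tree_rel_def)
    qed
    moreover obtain k where "\<And>t. (t, S k) \<in> tree_rel (factor_tree A \<alpha>) \<Longrightarrow> t \<notin> range S"
      using wfE_min[OF wf, of "S 0" "range S"] by (metis rangeE rangeI)
    ultimately show False by blast
  qed
next
  assume \<alpha>: "\<alpha> \<notin> inf_power n A"
  show "wf (tree_rel (factor_tree A \<alpha>))"
  proof (rule ccontr)
    assume "\<not> wf (tree_rel (factor_tree A \<alpha>))"
    then obtain f where f: "\<And>i. (f (Suc i), f i) \<in> tree_rel (factor_tree A \<alpha>)"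
      unfolding wf_iff_no_infinite_down_chain by blast
    have tree: "f i \<in> factor_tree A \<alpha>" and ext: "strict_prefix (f i) (f (Suc i))" for i
      using f[of i] by (auto simp: tree_rel_def)
    have len: "i \<le> length (f i)" for i
      by (induction i) (use ext prefix_length_less in \<open>force simp: Suc_le_eq intro: le_less_trans\<close>)+
    define a where "a i = f (Suc i) ! i" for i
    have pre: "prefix (map a [0..<k]) (f k)" for k
    proof (induction k)
      case (Suc k)
      have "take k (f (Suc k)) = map a [0..<k]"
        using Suc ext[of k] by (auto simp: prefix_def strict_prefix_def)
      hence "take (Suc k) (f (Suc k)) = map a [0..<Suc k]"
        using len[of "Suc k"] by (simp add: take_Suc_conv_app_nth a_def)
      thus ?case by (metis take_is_prefix)
    qed simp
    have in_A: "a i \<in> A - {[]}" for i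
    proof -
      have "a i \<in> set (f (Suc i))" using len[of "Suc i"] by (simp add: a_def)
      thus ?thesis using tree[of "Suc i"] by (auto simp: factor_tree_def)
    qed
    have "initial_segment (concat (map a [0..<k])) \<alpha>" for k
    proof (rule initial_segment_prefix)
      show "initial_segment (concat (f k)) \<alpha>" using tree by (simp add: factor_tree_def)
      show "prefix (concat (map a [0..<k])) (concat (f k))"
        using pre[of k] by (auto simp: prefix_def)
    qed
    moreover have "k \<le> length (concat (map a [0..<k]))" for k
    proof (induction k)
      case (Suc k)
      have "0 < length (a k)" using in_A[of k] by simp
      moreover have "length (concat (map a [0..<Suc k])) =
          length (concat (map a [0..<k])) + length (a k)" by simp
      ultimately show ?case using Suc by linarith
    qed simp
    ultimately have "is_inf_concat a \<alpha>" by (auto simp: is_inf_concat_def)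
    thus False using \<alpha> assms in_A by (auto simp: inf_power_def)
  qed
qed

lemma bdd_above_R_rank:
  "bdd_above ((\<lambda>\<alpha>. tree_rank (factor_tree A \<alpha>)) ` (topspace (cantor n) - inf_power n A))"
proof (rule bdd_aboveI[of _ "\<omega>\<^sub>1"])
  fix x assume "x \<in> (\<lambda>\<alpha>. tree_rank (factor_tree A \<alpha>)) ` (topspace (cantor n) - inf_power n A)"
  then obtain \<alpha> where \<alpha>: "x = tree_rank (factor_tree A \<alpha>)"
      "\<alpha> \<in> topspace (cantor n)" "\<alpha> \<notin> inf_power n A" by blast
  hence "wf (tree_rel (factor_tree A \<alpha>))" using wf_factor_tree_iff by blast
  hence "x < \<omega>\<^sub>1" unfolding \<alpha>(1) by (intro tree_rank_less_omega1 countableI_type)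
  thus "x \<le> \<omega>\<^sub>1" by simp
qed

end

theory Submission
  imports Defs
begin

text \<open>
  Why the theorem holds. The assertion that the root of a tree \<open>T\<close> has rank at least \<open>\<eta>\<close> makes
  sense for an arbitrary tree when it is unfolded recursively: for every \<open>\<zeta> < \<eta>\<close> some proper
  extension has rank at least \<open>\<zeta>\<close>. On well-founded trees this is the comparison
  \<open>\<eta> \<le> node_rank T []\<close>, whereas an ill-founded tree has root of rank at least every ordinal.
  Since the tree of factorizations of \<open>\<alpha>\<close> is ill-founded exactly for \<open>\<alpha>\<close> in \<open>A\<^sup>\<infinity>\<close>, and since the
  root of a well-founded factorization tree has rank strictly below \<open>R(A)\<close>, the set \<open>A\<^sup>\<infinity>\<close>
  consists of the \<open>\<alpha>\<close> whose factorization tree has root of rank at least \<open>R(A)\<close>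
  (\<open>inf_power_iff_rank_at_least\<close>).

  It remains to bound the Borel class of "the node \<open>s\<close> of \<open>T(\<alpha>)\<close> has rank at least
  \<open>\<omega> * \<xi> + r\<close>", for trees that depend on \<open>\<alpha>\<close> in such a way that membership of each node is a
  clopen condition (\<open>sigma0_in_rank_at_least\<close>). Raising the rank by one costs an existential
  quantifier over the countably many nodes, hence stays within an additive Borel class. Therefore
  \<open>\<omega>\<close> consecutive successor steps are free, and only the passage to \<open>\<omega> * \<xi>\<close> costs something: there
  the condition is the conjunction of the conditions for \<open>\<omega> * \<zeta> + r\<close> with \<open>\<zeta> < \<xi>\<close> and
  \<open>r\<close> finite, a countable intersection of sets in classes \<open>\<Sigma>\<^sup>0\<close> of index \<open>2 * \<zeta> + 1 < 2 * \<xi>\<close>.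
  For \<open>\<xi> > 0\<close> this yields a \<open>\<Pi>\<^sup>0\<close> set of index \<open>2 * \<xi>\<close>, which is \<open>\<Sigma>\<^sup>0\<close> of index \<open>2 * \<xi> + 1\<close>;
  for \<open>\<xi> = 0\<close> the condition is vacuous, and finitely many successor steps lead to open sets.
\<close>

section \<open>Ordinal arithmetic\<close>

lemma less_ord_succ: "x < ord_succ x"
  by (simp add: less_ord_succ_iff)

lemma ordinal_add_mono_right:
  fixes a b c :: ordinal
  assumes "c \<le> b"
  shows "a + c \<le> a + b"
proof (cases "c = b")
  case False
  hence "ord_succ (a + c) \<le> a + b" using assms by (intro ordinal_add_upper) simp
  thus ?thesis by (simp add: ord_succ_le_iff)
qed simp

lemma ordinal_add_ord_of_nat_Suc: "a + ord_of_nat (Suc r) = ord_succ (a + ord_of_nat r)"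
  by (simp add: ordinal_add_one ordinal_add_succ)

lemma ordinal_zero_add_one [simp]: "0 + 1 = (1 :: ordinal)"
  by (simp add: one_ordinal_def ordinal_add_succ)

lemma bdd_above_range_ord_of_nat: "bdd_above (range ord_of_nat)"
  by (simp add: bdd_above_countable_ordinal)

lemma ord_of_nat_le_omega: "ord_of_nat r \<le> \<omega>"
  unfolding omega_def by (simp add: bdd_above_range_ord_of_nat cSup_upper)

lemma less_omegaE:
  assumes "x < \<omega>"
  obtains r where "x < ord_of_nat r"
  using assms less_cSup_iff[OF _ bdd_above_range_ord_of_nat] unfolding omega_def by blast

lemma omega_mult_add_ord_of_nat_le:
  assumes "\<zeta> < \<xi>"
  shows "\<omega> * \<zeta> + ord_of_nat r \<le> \<omega> * \<xi>"
  using ordinal_add_mono_right[OF ord_of_nat_le_omega] ordinal_mult_upper[OF assms]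
  by (rule order_trans)

text \<open>Unfolding the product as the supremum of \<open>\<omega> * \<zeta> + \<omega>\<close> over \<open>\<zeta> < \<xi>\<close>, and then the sum with
  \<open>\<omega>\<close>, covers successor and limit \<open>\<xi>\<close> at once, which spares the Borel computation that case
  distinction. The bound is on \<open>ord_succ \<eta>\<close> because rank conditions at \<open>\<omega> * \<xi>\<close> decompose into
  conditions at successors.\<close>

lemma omega_mult_cofinal:
  assumes "\<eta> < \<omega> * \<xi>"
  obtains \<zeta> r where "\<zeta> < \<xi>" "ord_succ \<eta> \<le> \<omega> * \<zeta> + ord_of_nat r"
proof -
  have "\<xi> \<noteq> 0" using assms by (auto simp: leD)
  hence "0 \<in> {..<\<xi>}" by (simp add: less_le)
  hence "(\<lambda>c. \<omega> * c + \<omega>) ` {..<\<xi>} \<noteq> {}" by blast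
  then obtain \<zeta> where \<zeta>: "\<zeta> < \<xi>" "\<eta> < \<omega> * \<zeta> + \<omega>"
    using assms less_cSup_iff[OF _ bdd_above_image_ordinal, of "\<lambda>c. \<omega> * c + \<omega>" \<xi> \<eta>]
    by (subst (asm) times_ordinal.simps) auto
  let ?S = "insert (\<omega> * \<zeta>) ((\<lambda>c. ord_succ (\<omega> * \<zeta> + c)) ` {..<\<omega>})"
  have "\<eta> < Sup ?S"
    using \<zeta>(2) by (subst (asm) plus_ordinal.simps)
  moreover have "bdd_above ?S" by (simp add: bdd_above_image_ordinal)
  ultimately obtain x where x: "x \<in> ?S" "\<eta> < x"
    using less_cSup_iff[of ?S \<eta>] by blast
  show ?thesis
  proof (cases "x = \<omega> * \<zeta>")
    case True
    thus ?thesis using x(2) \<zeta>(1) that[of \<zeta> 0] by (simp add: ord_succ_le_iff)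
  next
    case False
    then obtain c where c: "c < \<omega>" "\<eta> < ord_succ (\<omega> * \<zeta> + c)" using x by auto
    obtain r where "c < ord_of_nat r" using c(1) by (rule less_omegaE)
    hence "ord_succ (\<omega> * \<zeta> + c) \<le> \<omega> * \<zeta> + ord_of_nat r" by (rule ordinal_add_upper)
    with c(2) have "\<eta> < \<omega> * \<zeta> + ord_of_nat r" by simp
    thus ?thesis using \<zeta>(1) by (auto simp: ord_succ_le_iff intro: that)
  qed
qed

lemma double_add_one_less:
  assumes "\<zeta> < \<xi>"
  shows "ord_of_nat 2 * \<zeta> + 1 < ord_of_nat 2 * \<xi>"
proof -
  have "ord_succ (ord_of_nat 2 * \<zeta> + 1) = ord_of_nat 2 * \<zeta> + ord_of_nat 2"
    by (simp add: numeral_2_eq_2 ordinal_add_one ordinal_add_succ)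
  also have "\<dots> \<le> ord_of_nat 2 * \<xi>" using assms by (rule ordinal_mult_upper)
  finally show ?thesis by (simp add: ord_succ_le_iff)
qed

section \<open>Closure properties of the Borel classes\<close>

lemma sigma0_in_cases:
  assumes "sigma0_in X \<xi> U"
  obtains (is_open) "\<xi> = 1" "openin X U"
  | (is_union) \<eta> P where "1 < \<xi>" "\<And>i::nat. \<eta> i < \<xi> \<and> pi0_in X (\<eta> i) (P i)" "U = (\<Union>i. P i)"
  using assms by (cases rule: sigma0_in.cases) blast+

lemma sigma0_in_Union_pi0_in:
  assumes "countable I" "I \<noteq> {}" "1 < \<xi>"
    and "\<And>i. i \<in> I \<Longrightarrow> \<eta> i < \<xi> \<and> pi0_in X (\<eta> i) (P i)"
  shows "sigma0_in X \<xi> (\<Union>i\<in>I. P i)"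
proof -
  have "sigma0_in X \<xi> (\<Union>k. P (from_nat_into I k))"
    using assms(3) assms(4)[OF from_nat_into[OF assms(2)]]
    by (rule sigma0_Union[where \<eta> = "\<lambda>k. \<eta> (from_nat_into I k)"])
  also have "(\<Union>k. P (from_nat_into I k)) = (\<Union>i\<in>range (from_nat_into I). P i)"
    by simp
  also have "range (from_nat_into I) = I"
    using assms(1,2) by (simp add: range_from_nat_into)
  finally show ?thesis .
qed

lemma sigma0_in_countable_Union:
  assumes "countable I" "I \<noteq> {}" and U: "\<And>i. i \<in> I \<Longrightarrow> sigma0_in X \<xi> (U i)"
  shows "sigma0_in X \<xi> (\<Union>i\<in>I. U i)"
proof (cases "\<xi> = 1")
  case True
  have "openin X (U i)" if "i \<in> I" for i
    using U[OF that] by (cases rule: sigma0_in_cases) (auto simp: True)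
  thus ?thesis unfolding True by (intro sigma0_open) blast
next
  case False
  obtain i where "i \<in> I" using assms(2) by blast
  with U[OF this] False have gt: "1 < \<xi>" by (auto elim: sigma0_in_cases)
  have "\<exists>\<eta> P. (\<forall>k::nat. \<eta> k < \<xi> \<and> pi0_in X (\<eta> k) (P k)) \<and> U i = (\<Union>k. P k)"
    if "i \<in> I" for i
    using U[OF that] by (cases rule: sigma0_in_cases) (use False in blast)+
  then obtain \<eta> P where P: "\<And>i k. i \<in> I \<Longrightarrow> \<eta> i (k::nat) < \<xi> \<and> pi0_in X (\<eta> i k) (P i k)"
    "\<And>i. i \<in> I \<Longrightarrow> U i = (\<Union>k. P i k)"
    by metis
  have "sigma0_in X \<xi> (\<Union>p\<in>I \<times> (UNIV :: nat set). P (fst p) (snd p))"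
    by (rule sigma0_in_Union_pi0_in[where \<eta> = "\<lambda>p. \<eta> (fst p) (snd p)"])
      (use assms(1,2) gt P(1) in auto)
  also have "(\<Union>p\<in>I \<times> (UNIV :: nat set). P (fst p) (snd p)) = (\<Union>i\<in>I. U i)"
    using P(2) by fastforce
  finally show ?thesis .
qed

lemma pi0_in_imp_sigma0_in:
  assumes "pi0_in X \<eta> P" "\<eta> < \<xi>" "1 < \<xi>"
  shows "sigma0_in X \<xi> P"
  using sigma0_Union[of \<xi> "\<lambda>_. \<eta>" X "\<lambda>_. P"] assms by simp

lemma pi0_in_closedin:
  assumes "closedin X C"
  shows "pi0_in X 1 C"
  using pi0_compl[OF sigma0_open, of X "topspace X - C"] assms
  by (auto simp: closedin_def double_diff)

lemma sigma0_in_clopen: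
  assumes "openin X C" "closedin X C" "1 \<le> \<xi>"
  shows "sigma0_in X \<xi> C"
  using assms pi0_in_imp_sigma0_in[OF pi0_in_closedin, of X C \<xi>] sigma0_open[of X C]
  by (cases "\<xi> = 1") auto

text \<open>A successor step in rank intersects with the clopen condition that a node belongs to the tree.
  Unions with clopen sets come first because, after complementation, they give intersections for
  the multiplicative classes, and these pass through the defining unions of the additive ones.\<close>

lemma sigma0_in_Un_clopen:
  assumes "sigma0_in X \<xi> U" "openin X C" "closedin X C"
  shows "sigma0_in X \<xi> (U \<union> C)"
proof -
  have "1 \<le> \<xi>" using assms(1) by (cases rule: sigma0_in_cases) auto
  hence "sigma0_in X \<xi> (\<Union>V\<in>{U, C}. V)"
    using assms by (intro sigma0_in_countable_Union) (auto intro: sigma0_in_clopen)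
  thus ?thesis by simp
qed

lemma pi0_in_Int_clopen:
  assumes "pi0_in X \<xi> P" "openin X C" "closedin X C"
  shows "pi0_in X \<xi> (P \<inter> C)"
proof -
  obtain U where U: "P = topspace X - U" "sigma0_in X \<xi> U"
    using assms(1) by (cases rule: pi0_in.cases) blast
  have "pi0_in X \<xi> (topspace X - (U \<union> (topspace X - C)))"
    using assms(2,3) by (intro pi0_compl sigma0_in_Un_clopen U(2)) auto
  also have "topspace X - (U \<union> (topspace X - C)) = P \<inter> C"
    using closedin_subset[OF assms(3)] U(1) by blast
  finally show ?thesis .
qed

lemma sigma0_in_Int_clopen:
  assumes "sigma0_in X \<xi> U" "openin X C" "closedin X C"
  shows "sigma0_in X \<xi> (U \<inter> C)"
  using assms(1)
proof (cases rule: sigma0_in_cases)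
  case is_open
  thus ?thesis using assms(2) by (auto intro: sigma0_open)
next
  case (is_union \<eta> P)
  have "sigma0_in X \<xi> (\<Union>i. P i \<inter> C)"
    using is_union(1,2) assms(2,3) by (intro sigma0_Union[of _ \<eta>]) (auto intro: pi0_in_Int_clopen)
  thus ?thesis unfolding is_union(3) by (simp add: Int_commute)
qed

section \<open>Rank bounds for arbitrary trees\<close>

text \<open>Recursion on the ordinal instead of on the tree gives a notion that is meaningful on ill-founded
  trees, too, where it is true along infinite branches for every ordinal.\<close>

function rank_at_least :: "'a list set \<Rightarrow> ordinal \<Rightarrow> 'a list \<Rightarrow> bool" where
  "rank_at_least T \<eta> s \<longleftrightarrow> (\<forall>\<zeta><\<eta>. \<exists>t. (t, s) \<in> tree_rel T \<and> rank_at_least T \<zeta> t)"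
  by auto
termination
  by (relation "inv_image {(x, y). x < y} (\<lambda>(T, \<eta>, s). \<eta>)") (auto simp: wf)

declare rank_at_least.simps [simp del]

lemma rank_at_least_zero [simp]: "rank_at_least T 0 s"
  by (subst rank_at_least.simps) (simp add: leD)

lemma rank_at_least_antimono:
  "rank_at_least T \<eta> s \<Longrightarrow> \<zeta> \<le> \<eta> \<Longrightarrow> rank_at_least T \<zeta> s"
  by (subst (asm) rank_at_least.simps, subst rank_at_least.simps) auto

lemma rank_at_least_succ:
  "rank_at_least T (ord_succ \<eta>) s \<longleftrightarrow> (\<exists>t. (t, s) \<in> tree_rel T \<and> rank_at_least T \<eta> t)"
  by (subst rank_at_least.simps)
    (auto simp: less_ord_succ_iff intro: rank_at_least_antimono)

lemma rank_at_least_iff_succ: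
  "rank_at_least T \<eta> s \<longleftrightarrow> (\<forall>\<zeta><\<eta>. rank_at_least T (ord_succ \<zeta>) s)"
  unfolding rank_at_least_succ by (rule rank_at_least.simps)

lemma rank_at_least_omega_mult:
  "rank_at_least T (\<omega> * \<xi>) s \<longleftrightarrow>
    (\<forall>\<zeta><\<xi>. \<forall>r. rank_at_least T (\<omega> * \<zeta> + ord_of_nat r) s)"
proof
  assume R: "\<forall>\<zeta><\<xi>. \<forall>r. rank_at_least T (\<omega> * \<zeta> + ord_of_nat r) s"
  show "rank_at_least T (\<omega> * \<xi>) s"
    unfolding rank_at_least_iff_succ[of T "\<omega> * \<xi>"]
    by (meson R omega_mult_cofinal rank_at_least_antimono)
qed (blast intro: rank_at_least_antimono omega_mult_add_ord_of_nat_le)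

text \<open>Countability of the set of nodes ensures that the suprema in the definitions of the ranks are
  upper bounds, since every countable set of ordinals is bounded.\<close>

lemma node_rank_less:
  fixes T :: "'a::countable list set"
  assumes "wf (tree_rel T)" "(t, s) \<in> tree_rel T"
  shows "node_rank T t < node_rank T s"
proof -
  have "node_rank T t + 1 \<le> (SUP t \<in> {t \<in> T. strict_prefix s t}. node_rank T t + 1)"
    using assms(2)
    by (intro cSUP_upper bdd_above_countable_ordinal) (auto simp: tree_rel_def)
  also have "\<dots> = node_rank T s"
    using assms by (intro node_rank_eq[symmetric]) (auto simp: tree_rel_def)
  finally show ?thesis by (simp add: ordinal_add_one ord_succ_le_iff)
qed

lemma rank_at_least_imp_le_node_rank:
  fixes T :: "'a::countable list set"
  assumes "wf (tree_rel T)" "rank_at_least T \<eta> s"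
  shows "\<eta> \<le> node_rank T s"
  using assms(2)
proof (induction \<eta> arbitrary: s rule: less_induct)
  case (less \<eta>)
  show ?case
  proof (rule ccontr)
    assume "\<not> \<eta> \<le> node_rank T s"
    hence lt: "node_rank T s < \<eta>" by simp
    then obtain t where t: "(t, s) \<in> tree_rel T" "rank_at_least T (node_rank T s) t"
      using less.prems by (subst (asm) rank_at_least.simps) blast
    have "node_rank T s \<le> node_rank T t"
      using lt t(2) by (rule less.IH)
    with node_rank_less[OF assms(1) t(1)] show False by simp
  qed
qed

lemma node_rank_less_tree_rank:
  fixes T :: "'a::countable list set"
  assumes "s \<in> T"
  shows "node_rank T s < tree_rank T"
proof -
  have "node_rank T s + 1 \<le> tree_rank T"
    unfolding tree_rank_def using assms
    by (intro cSUP_upper bdd_above_countable_ordinal) auto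
  thus ?thesis by (simp add: ordinal_add_one ord_succ_le_iff)
qed

text \<open>Along an infinite branch the recursion never runs out of extensions; the root lies below
  every branch.\<close>

lemma not_wf_imp_rank_at_least_root:
  assumes "\<not> wf (tree_rel T)" "[] \<in> T"
  shows "rank_at_least T \<eta> []"
proof -
  obtain f where f: "\<And>i. (f (Suc i), f i) \<in> tree_rel T"
    using assms(1) unfolding wf_iff_no_infinite_down_chain by blast
  have branch: "rank_at_least T \<eta> (f i)" for \<eta> i
  proof (induction \<eta> arbitrary: i rule: less_induct)
    case (less \<eta>)
    thus ?case using f by (subst rank_at_least.simps) blast
  qed
  have "(f 1, []) \<in> tree_rel T"
    using f[of 0] assms(2) by (auto simp: tree_rel_def strict_prefix_def)
  thus ?thesis using branch by (subst rank_at_least.simps) blast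
qed

section \<open>The Borel class of a rank bound\<close>

text \<open>The inner induction on \<open>r\<close> absorbs finitely many existential quantifiers over nodes into the
  class that \<open>\<omega> * \<xi>\<close> has reached; the outer induction on \<open>\<xi>\<close> raises the index by two, once for the
  countable intersection over the ranks below \<open>\<omega> * \<xi>\<close>, and once for turning the resulting
  multiplicative class into an additive one.\<close>

lemma sigma0_in_rank_at_least:
  fixes T :: "'x \<Rightarrow> 'a::countable list set"
  assumes open_T: "\<And>s. openin X {x \<in> topspace X. s \<in> T x}"
    and closed_T: "\<And>s. closedin X {x \<in> topspace X. s \<in> T x}"
    and "\<xi> < \<omega>\<^sub>1"
  shows "sigma0_in X (ord_of_nat 2 * \<xi> + 1)
    {x \<in> topspace X. rank_at_least (T x) (\<omega> * \<xi> + ord_of_nat r) s}"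
  using assms(3)
proof (induction \<xi> arbitrary: r s rule: less_induct)
  case (less \<xi>)
  let ?G = "\<lambda>\<eta> s. {x \<in> topspace X. rank_at_least (T x) \<eta> s}"
  let ?two = "ord_of_nat 2"
  have base: "sigma0_in X (?two * \<xi> + 1) (?G (\<omega> * \<xi>) s)" for s
  proof (cases "\<xi> = 0")
    case True
    thus ?thesis by (simp add: sigma0_open)
  next
    case False
    hence pos: "0 < \<xi>" by (simp add: less_le)
    let ?I = "{..<\<xi>} \<times> (UNIV :: nat set)"
    let ?H = "\<lambda>p. topspace X - ?G (\<omega> * fst p + ord_of_nat (snd p)) s"
    have gt: "1 < ?two * \<xi>"
      using double_add_one_less[OF pos] by simp
    have "sigma0_in X (?two * \<xi>) (\<Union>p\<in>?I. ?H p)"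
    proof (rule sigma0_in_Union_pi0_in[where \<eta> = "\<lambda>p. ?two * fst p + 1"])
      show "countable ?I" using less.prems by (simp add: less_omega1_iff)
      show "?I \<noteq> {}" using pos by auto
      fix p assume "p \<in> ?I"
      hence "fst p < \<xi>" by auto
      thus "?two * fst p + 1 < ?two * \<xi> \<and> pi0_in X (?two * fst p + 1) (?H p)"
        using less.prems by (auto intro!: double_add_one_less pi0_compl less.IH)
    qed (rule gt)
    hence "pi0_in X (?two * \<xi>) (topspace X - (\<Union>p\<in>?I. ?H p))" by (rule pi0_compl)
    also have "topspace X - (\<Union>p\<in>?I. ?H p) = ?G (\<omega> * \<xi>) s"
      unfolding rank_at_least_omega_mult by fastforce
    finally show ?thesis
    proof (rule pi0_in_imp_sigma0_in)
      show "?two * \<xi> < ?two * \<xi> + 1" by (simp add: ordinal_add_one less_ord_succ)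
      thus "1 < ?two * \<xi> + 1" using gt by simp
    qed
  qed
  show ?case
  proof (induction r arbitrary: s)
    case 0
    show ?case using base by simp
  next
    case (Suc r)
    let ?C = "\<lambda>t. {x \<in> topspace X. (t, s) \<in> tree_rel (T x)}"
    have C: "openin X (?C t) \<and> closedin X (?C t)" for t
    proof (cases "strict_prefix s t")
      case True
      hence "?C t = {x \<in> topspace X. s \<in> T x} \<inter> {x \<in> topspace X. t \<in> T x}"
        by (auto simp: tree_rel_def)
      thus ?thesis by (simp add: openin_Int closedin_Int open_T closed_T)
    qed (simp add: tree_rel_def)
    have "sigma0_in X (?two * \<xi> + 1) (\<Union>t\<in>UNIV. ?G (\<omega> * \<xi> + ord_of_nat r) t \<inter> ?C t)"
      using C by (intro sigma0_in_countable_Union sigma0_in_Int_clopen Suc.IH) auto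
    also have "(\<Union>t\<in>UNIV. ?G (\<omega> * \<xi> + ord_of_nat r) t \<inter> ?C t) =
        ?G (\<omega> * \<xi> + ord_of_nat (Suc r)) s"
      unfolding ordinal_add_ord_of_nat_Suc rank_at_least_succ by blast
    finally show ?case .
  qed
qed

section \<open>Factorization trees\<close>

lemma clopen_coordinate:
  "openin (cantor n) {\<alpha> \<in> topspace (cantor n). \<alpha> i = c}"
  "closedin (cantor n) {\<alpha> \<in> topspace (cantor n). \<alpha> i = c}"
proof -
  have cont: "continuous_map (cantor n) (discrete_topology {..<n}) (\<lambda>\<alpha>. \<alpha> i)"
    by (rule continuous_map_product_projection) simp
  have eq: "{\<alpha> \<in> topspace (cantor n). \<alpha> i = c} =
      {\<alpha> \<in> topspace (cantor n). \<alpha> i \<in> {c} \<inter> {..<n}}"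
    by auto
  show "openin (cantor n) {\<alpha> \<in> topspace (cantor n). \<alpha> i = c}"
    unfolding eq by (rule openin_continuous_map_preimage[OF cont]) simp
  show "closedin (cantor n) {\<alpha> \<in> topspace (cantor n). \<alpha> i = c}"
    unfolding eq by (rule closedin_continuous_map_preimage[OF cont]) simp
qed

lemma clopen_initial_segment:
  "openin (cantor n) {\<alpha> \<in> topspace (cantor n). initial_segment w \<alpha>} \<and>
   closedin (cantor n) {\<alpha> \<in> topspace (cantor n). initial_segment w \<alpha>}"
proof (induction w rule: rev_induct)
  case Nil
  show ?case by (simp add: initial_segment_def del: topspace_product_topology)
next
  case (snoc c w)
  have "{\<alpha> \<in> topspace (cantor n). initial_segment (w @ [c]) \<alpha>} =
      {\<alpha> \<in> topspace (cantor n). initial_segment w \<alpha>} \<inter>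
      {\<alpha> \<in> topspace (cantor n). \<alpha> (length w) = c}"
    by (auto simp: initial_segment_def)
  thus ?case using snoc clopen_coordinate[of n "length w" c]
    by (simp only: openin_Int closedin_Int)
qed

lemma clopen_factor_tree:
  "openin (cantor n) {\<alpha> \<in> topspace (cantor n). S \<in> factor_tree A \<alpha>} \<and>
   closedin (cantor n) {\<alpha> \<in> topspace (cantor n). S \<in> factor_tree A \<alpha>}"
  using clopen_initial_segment[of n "concat S"]
  by (cases "set S \<subseteq> A - {[]}")
    (simp_all add: factor_tree_def del: topspace_product_topology)

text \<open>Outside \<open>A\<^sup>\<infinity>\<close> the rank of the tree exceeds the rank of its root, so its root has rank strictly
  below the supremum of the ranks of the trees.\<close>

lemma inf_power_iff_rank_at_least:
  assumes "\<alpha> \<in> topspace (cantor n)"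
  shows "\<alpha> \<in> inf_power n A \<longleftrightarrow> rank_at_least (factor_tree A \<alpha>) (R_rank n A) []"
proof
  have root: "[] \<in> factor_tree A \<alpha>" by (simp add: factor_tree_def initial_segment_def)
  show "rank_at_least (factor_tree A \<alpha>) (R_rank n A) []" if "\<alpha> \<in> inf_power n A"
    using that wf_factor_tree_iff[OF assms] root by (intro not_wf_imp_rank_at_least_root) auto
  show "\<alpha> \<in> inf_power n A" if ge: "rank_at_least (factor_tree A \<alpha>) (R_rank n A) []"
  proof (rule ccontr)
    assume notin: "\<alpha> \<notin> inf_power n A"
    hence "wf (tree_rel (factor_tree A \<alpha>))" using wf_factor_tree_iff[OF assms] by blast
    hence "R_rank n A \<le> node_rank (factor_tree A \<alpha>) []"
      using ge by (rule rank_at_least_imp_le_node_rank)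
    also have "\<dots> < tree_rank (factor_tree A \<alpha>)" using root by (rule node_rank_less_tree_rank)
    also have "\<dots> \<le> R_rank n A"
      unfolding R_rank_def using assms notin by (intro cSUP_upper bdd_above_R_rank) blast
    finally show False by simp
  qed
qed

theorem proposition21:
  fixes n r :: nat and A :: "nat list set" and \<xi> :: ordinal
  assumes "2 \<le> n"
    and "A \<subseteq> lists {..<n}"
    and "\<xi> < \<omega>\<^sub>1"
    and "R_rank n A = \<omega> * \<xi> + ord_of_nat r"
  shows "sigma0_in (cantor n) (ord_of_nat 2 * \<xi> + 1) (inf_power n A)"
proof -
  have "inf_power n A \<subseteq> topspace (cantor n)" by (auto simp: inf_power_def)
  hence "inf_power n A = {\<alpha> \<in> topspace (cantor n).
      rank_at_least (factor_tree A \<alpha>) (\<omega> * \<xi> + ord_of_nat r) []}"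
    using inf_power_iff_rank_at_least unfolding assms(4)[symmetric] by blast
  thus ?thesis
    using sigma0_in_rank_at_least[OF clopen_factor_tree[THEN conjunct1]
        clopen_factor_tree[THEN conjunct2] assms(3)] by simp
qed

end
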